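(* Let $(T,\mu,\eta)$ be a dagger Frobenius monad on a dagger category $\mathbf{C}$. The dagger on $\mathbf{C}$ induces one on $\mathrm{FEM}(T)$; that is, if $f\colon(A,a)\to(B,b)$ is a homomorphism of FEM-algebras, then $f^\dagger$ is a homomorphism $(B,b)\to(A,a)$, so that $f\mapsto f^\dagger$ is a dagger on $\mathrm{FEM}(T)$.
   Context: A dagger on a category $\mathbf{D}$ is a functor $\dagger\colon\mathbf{D}^{\mathrm{op}}\to\mathbf{D}$ with $A^\dagger=A$ on objects and $f^{\dagger\dagger}=f$ on morphisms; a dagger category is a category with a chosen dagger. A dagger Frobenius monad on a dagger category $\mathbf{C}$ is a monad $(T,\mu,\eta)$ on $\mathbf{C}$ such that $T(f^\dagger)=T(f)^\dagger$ for all morphisms $f$ and, for every object $A$, $T(\mu_A)\circ\mu_{T(A)}^\dagger=\mu_{T(A)}\circ T(\mu_A^\dagger)$. For a monad $T$ on a dagger category, a Frobenius-Eilenberg-Moore algebra (FEM-algebra) is an Eilenberg-Moore algebra $a\colon T(A)\to A$ such that $\mu_A\circ T(a)^\dagger=T(a)\circ\mu_A^\dagger\colon T(A)\to T(A)$. $\mathrm{FEM}(T)$ is the category of FEM-algebras $(A,a)$ and algebra homomorphisms. *)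

theory Defs
  imports Main
begin

record ('o, 'm) category =
  Ob :: "'o set"
  Arr :: "'m set"
  Dom :: "'m \<Rightarrow> 'o"
  Cod :: "'m \<Rightarrow> 'o"
  Id :: "'o \<Rightarrow> 'm"
  Comp :: "'m \<Rightarrow> 'm \<Rightarrow> 'm"  (infixr "\<cdot>\<index>" 70)

definition Hom :: "('o, 'm, 'z) category_scheme \<Rightarrow> 'o \<Rightarrow> 'o \<Rightarrow> 'm set" where
  "Hom C A B = {f \<in> Arr C. Dom C f = A \<and> Cod C f = B}"

text \<open>Composition is in applicative order and is only constrained on composable pairs;
  all operations are unspecified outside the objects and arrows.\<close>

locale category =
  fixes C (structure)
  assumes dom_ob: "f \<in> Arr C \<Longrightarrow> Dom C f \<in> Ob C"
    and cod_ob: "f \<in> Arr C \<Longrightarrow> Cod C f \<in> Ob C"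
    and id_hom: "A \<in> Ob C \<Longrightarrow> Id C A \<in> Hom C A A"
    and comp_hom: "\<lbrakk>f \<in> Hom C A B; g \<in> Hom C B D\<rbrakk> \<Longrightarrow> g \<cdot> f \<in> Hom C A D"
    and id_left: "f \<in> Hom C A B \<Longrightarrow> Id C B \<cdot> f = f"
    and id_right: "f \<in> Hom C A B \<Longrightarrow> f \<cdot> Id C A = f"
    and comp_assoc:
      "\<lbrakk>f \<in> Hom C A B; g \<in> Hom C B D; h \<in> Hom C D E\<rbrakk> \<Longrightarrow> (h \<cdot> g) \<cdot> f = h \<cdot> (g \<cdot> f)"

definition opposite :: "('o, 'm) category \<Rightarrow> ('o, 'm) category" where
  "opposite C = \<lparr>Ob = Ob C, Arr = Arr C, Dom = Cod C, Cod = Dom C, Id = Id C,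
     Comp = (\<lambda>g f. f \<cdot>\<^bsub>C\<^esub> g)\<rparr>"

locale cat_functor = source: category C + target: category D
  for C :: "('o, 'm) category" and D :: "('p, 'n) category"
    and Fo :: "'o \<Rightarrow> 'p" and Fa :: "'m \<Rightarrow> 'n" +
  assumes map_ob: "A \<in> Ob C \<Longrightarrow> Fo A \<in> Ob D"
    and map_hom: "f \<in> Hom C A B \<Longrightarrow> Fa f \<in> Hom D (Fo A) (Fo B)"
    and map_id: "A \<in> Ob C \<Longrightarrow> Fa (Id C A) = Id D (Fo A)"
    and map_comp: "\<lbrakk>f \<in> Hom C A B; g \<in> Hom C B E\<rbrakk> \<Longrightarrow> Fa (g \<cdot>\<^bsub>C\<^esub> f) = Fa g \<cdot>\<^bsub>D\<^esub> Fa f"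

locale nat_trans = F: cat_functor C D Fo Fa + G: cat_functor C D Go Ga
  for C :: "('o, 'm) category" and D :: "('p, 'n) category" and Fo Fa Go Ga
    and \<tau> :: "'o \<Rightarrow> 'n" +
  assumes component: "A \<in> Ob C \<Longrightarrow> \<tau> A \<in> Hom D (Fo A) (Go A)"
    and naturality: "f \<in> Hom C A B \<Longrightarrow> \<tau> B \<cdot>\<^bsub>D\<^esub> Fa f = Ga f \<cdot>\<^bsub>D\<^esub> \<tau> A"

text \<open>A dagger is given by its action on arrows; the action on objects is the identity.\<close>

locale dagger_category = category C for C :: "('o, 'm) category" +
  fixes dag :: "'m \<Rightarrow> 'm"
  assumes dagger_functor: "cat_functor (opposite C) C (\<lambda>A. A) dag"
    and dagger_involutive: "f \<in> Arr C \<Longrightarrow> dag (dag f) = f"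

locale cat_monad = category C
  for C :: "('o, 'm) category" (structure) +
  fixes To :: "'o \<Rightarrow> 'o" and Ta :: "'m \<Rightarrow> 'm" and \<mu> \<eta> :: "'o \<Rightarrow> 'm"
  assumes endofunctor: "cat_functor C C To Ta"
    and mult_nat: "nat_trans C C (\<lambda>A. To (To A)) (\<lambda>f. Ta (Ta f)) To Ta \<mu>"
    and unit_nat: "nat_trans C C (\<lambda>A. A) (\<lambda>f. f) To Ta \<eta>"
    and mult_assoc: "A \<in> Ob C \<Longrightarrow> \<mu> A \<cdot> Ta (\<mu> A) = \<mu> A \<cdot> \<mu> (To A)"
    and unit_left: "A \<in> Ob C \<Longrightarrow> \<mu> A \<cdot> \<eta> (To A) = Id C (To A)"
    and unit_right: "A \<in> Ob C \<Longrightarrow> \<mu> A \<cdot> Ta (\<eta> A) = Id C (To A)"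

locale dagger_frobenius_monad = dagger_category C dag + cat_monad C To Ta \<mu> \<eta>
  for C :: "('o, 'm) category" (structure) and dag To Ta \<mu> \<eta> +
  assumes functor_dagger: "f \<in> Arr C \<Longrightarrow> Ta (dag f) = dag (Ta f)"
    and frobenius_law:
      "A \<in> Ob C \<Longrightarrow> Ta (\<mu> A) \<cdot> dag (\<mu> (To A)) = \<mu> (To A) \<cdot> Ta (dag (\<mu> A))"

definition EM_algebra ::
  "('o, 'm) category \<Rightarrow> ('o \<Rightarrow> 'o) \<Rightarrow> ('m \<Rightarrow> 'm) \<Rightarrow> ('o \<Rightarrow> 'm) \<Rightarrow> ('o \<Rightarrow> 'm) \<Rightarrow> 'o \<times> 'm \<Rightarrow> bool" where
  "EM_algebra C To Ta \<mu> \<eta> = (\<lambda>(A, a).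
     A \<in> Ob C \<and> a \<in> Hom C (To A) A \<and>
     a \<cdot>\<^bsub>C\<^esub> \<eta> A = Id C A \<and>
     a \<cdot>\<^bsub>C\<^esub> \<mu> A = a \<cdot>\<^bsub>C\<^esub> Ta a)"

definition FEM_algebra ::
  "('o, 'm) category \<Rightarrow> ('m \<Rightarrow> 'm) \<Rightarrow> ('o \<Rightarrow> 'o) \<Rightarrow> ('m \<Rightarrow> 'm) \<Rightarrow> ('o \<Rightarrow> 'm) \<Rightarrow> ('o \<Rightarrow> 'm)
    \<Rightarrow> 'o \<times> 'm \<Rightarrow> bool" where
  "FEM_algebra C dag To Ta \<mu> \<eta> = (\<lambda>(A, a).
     EM_algebra C To Ta \<mu> \<eta> (A, a) \<and>
     \<mu> A \<cdot>\<^bsub>C\<^esub> dag (Ta a) = Ta a \<cdot>\<^bsub>C\<^esub> dag (\<mu> A))"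

definition algebra_hom ::
  "('o, 'm) category \<Rightarrow> ('m \<Rightarrow> 'm) \<Rightarrow> 'o \<times> 'm \<Rightarrow> 'o \<times> 'm \<Rightarrow> 'm \<Rightarrow> bool" where
  "algebra_hom C Ta = (\<lambda>(A, a) (B, b) f.
     f \<in> Hom C A B \<and> f \<cdot>\<^bsub>C\<^esub> a = b \<cdot>\<^bsub>C\<^esub> Ta f)"

text \<open>One and the same arrow of the base category may underlie homomorphisms between different
  algebras, so an arrow of the category of FEM-algebras is a triple (source algebra,
  underlying arrow, target algebra).\<close>

definition FEM ::
  "('o, 'm) category \<Rightarrow> ('m \<Rightarrow> 'm) \<Rightarrow> ('o \<Rightarrow> 'o) \<Rightarrow> ('m \<Rightarrow> 'm) \<Rightarrow> ('o \<Rightarrow> 'm) \<Rightarrow> ('o \<Rightarrow> 'm)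
    \<Rightarrow> ('o \<times> 'm, ('o \<times> 'm) \<times> 'm \<times> ('o \<times> 'm)) category" where
  "FEM C dag To Ta \<mu> \<eta> =
    \<lparr>Ob = {X. FEM_algebra C dag To Ta \<mu> \<eta> X},
     Arr = {(X, f, Y). FEM_algebra C dag To Ta \<mu> \<eta> X \<and> FEM_algebra C dag To Ta \<mu> \<eta> Y \<and>
                       algebra_hom C Ta X Y f},
     Dom = (\<lambda>(X, f, Y). X),
     Cod = (\<lambda>(X, f, Y). Y),
     Id = (\<lambda>(A, a). ((A, a), Id C A, (A, a))),
     Comp = (\<lambda>(Y, g, Z) (X, f, Y'). (X, g \<cdot>\<^bsub>C\<^esub> f, Z))\<rparr>"

definition FEM_dagger ::
  "('m \<Rightarrow> 'm) \<Rightarrow> ('o \<times> 'm) \<times> 'm \<times> ('o \<times> 'm) \<Rightarrow> ('o \<times> 'm) \<times> 'm \<times> ('o \<times> 'm)" where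
  "FEM_dagger dag = (\<lambda>(X, f, Y). (Y, dag f, X))"

end

(* Naturality of \<eta> and the FEM condition give T(a) \<circ> \<mu>\<^sub>A\<^sup>\<dagger> \<circ> \<eta>\<^sub>A = \<mu>\<^sub>A \<circ> T(a\<^sup>\<dagger>) \<circ> \<eta>\<^sub>A = \<mu>\<^sub>A \<circ> \<eta>\<^sub>T\<^sub>A \<circ> a\<^sup>\<dagger> = a\<^sup>\<dagger>,
   so a\<^sup>\<dagger> is built from T(a) and components of natural transformations (\<mu>\<^sup>\<dagger> is natural because T
   preserves daggers). Hence a homomorphism f satisfies b\<^sup>\<dagger> \<circ> f = T(f) \<circ> a\<^sup>\<dagger>, which is the dagger
   of the assertion that f\<^sup>\<dagger> is a homomorphism. *)

theory Submission
  imports Defs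
begin

section \<open>Hom-sets and opposite categories\<close>

lemma arr_of_hom: "f \<in> Hom C A B \<Longrightarrow> f \<in> Arr C"
  by (simp add: Hom_def)

lemma (in category) Hom_obs:
  assumes "f \<in> Hom C A B"
  shows "A \<in> Ob C" "B \<in> Ob C"
  using assms dom_ob cod_ob by (auto simp: Hom_def)

lemma Hom_opposite [simp]: "Hom (opposite C) A B = Hom C B A"
  by (auto simp: Hom_def opposite_def)

text \<open>A dagger is a functor out of the opposite category, and \<open>cat_functor\<close> asks
  that its source be a category.\<close>

lemma category_opposite:
  fixes C :: "('o, 'm) category"
  assumes "category C"
  shows "category (opposite C)"
proof -
  interpret category C by fact
  show ?thesis
  proof
    fix f g h A B D E
    show "f \<in> Arr (opposite C) \<Longrightarrow> Dom (opposite C) f \<in> Ob (opposite C)"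
      "f \<in> Arr (opposite C) \<Longrightarrow> Cod (opposite C) f \<in> Ob (opposite C)"
      by (auto simp: opposite_def dom_ob cod_ob)
    show "A \<in> Ob (opposite C) \<Longrightarrow> Id (opposite C) A \<in> Hom (opposite C) A A"
      \<comment> \<open>The hom-sets are turned round first: once \<open>opposite_def\<close> has
        unfolded \<open>opposite C\<close>, the rule \<open>Hom_opposite\<close> no longer
        matches.\<close>
      unfolding Hom_opposite by (simp add: opposite_def id_hom)
    show "\<lbrakk>f \<in> Hom (opposite C) A B; g \<in> Hom (opposite C) B D\<rbrakk>
        \<Longrightarrow> g \<cdot>\<^bsub>opposite C\<^esub> f \<in> Hom (opposite C) A D"
      unfolding Hom_opposite by (simp add: opposite_def comp_hom)
    show "f \<in> Hom (opposite C) A B \<Longrightarrow> Id (opposite C) B \<cdot>\<^bsub>opposite C\<^esub> f = f"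
      "f \<in> Hom (opposite C) A B \<Longrightarrow> f \<cdot>\<^bsub>opposite C\<^esub> Id (opposite C) A = f"
      unfolding Hom_opposite by (simp_all add: opposite_def id_left id_right)
    show "\<lbrakk>f \<in> Hom (opposite C) A B; g \<in> Hom (opposite C) B D; h \<in> Hom (opposite C) D E\<rbrakk>
        \<Longrightarrow> (h \<cdot>\<^bsub>opposite C\<^esub> g) \<cdot>\<^bsub>opposite C\<^esub> f = h \<cdot>\<^bsub>opposite C\<^esub> (g \<cdot>\<^bsub>opposite C\<^esub> f)"
      unfolding Hom_opposite by (simp add: opposite_def comp_assoc)
  qed
qed

context dagger_category
begin

lemma dag_hom: "f \<in> Hom C A B \<Longrightarrow> dag f \<in> Hom C B A"
  using cat_functor.map_hom[OF dagger_functor] by simp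

lemma dag_id: "A \<in> Ob C \<Longrightarrow> dag (Id C A) = Id C A"
  using cat_functor.map_id[OF dagger_functor] by (simp add: opposite_def)

lemma dag_comp:
  assumes "f \<in> Hom C A B" "g \<in> Hom C B D"
  shows "dag (g \<cdot>\<^bsub>C\<^esub> f) = dag f \<cdot>\<^bsub>C\<^esub> dag g"
  \<comment> \<open>In the opposite category \<open>g\<close> comes first, from \<open>D\<close> to
    \<open>B\<close>, followed by \<open>f\<close> from \<open>B\<close> to
    \<open>A\<close>.\<close>
  using cat_functor.map_comp[OF dagger_functor, of g D B f A] assms
  unfolding Hom_opposite by (simp add: opposite_def)

lemma dag_dag: "f \<in> Hom C A B \<Longrightarrow> dag (dag f) = f"
  by (simp add: arr_of_hom dagger_involutive)

end

section \<open>Algebra homomorphisms and the category of FEM-algebras\<close>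

lemma algebra_hom_id:
  assumes "cat_functor C C To Ta" "a \<in> Hom C (To A) A"
  shows "algebra_hom C Ta (A, a) (A, a) (Id C A)"
proof -
  interpret T: cat_functor C C To Ta by fact
  have "A \<in> Ob C" using assms(2) T.source.Hom_obs by blast
  then show ?thesis
    using assms(2)
    by (simp add: algebra_hom_def T.source.id_hom T.map_id T.source.id_left T.source.id_right)
qed

text \<open>The squares of \<open>f\<close> and \<open>g\<close> are pasted along \<open>b\<close>;
  functoriality then merges \<open>Ta g\<close> and \<open>Ta f\<close>.\<close>

lemma algebra_hom_comp:
  assumes "cat_functor C C To Ta"
    and a: "a \<in> Hom C (To A) A" and b: "b \<in> Hom C (To B) B" and d: "d \<in> Hom C (To D) D"
    and "algebra_hom C Ta (A, a) (B, b) f" "algebra_hom C Ta (B, b) (D, d) g"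
  shows "algebra_hom C Ta (A, a) (D, d) (g \<cdot>\<^bsub>C\<^esub> f)"
proof -
  interpret T: cat_functor C C To Ta by fact
  have f: "f \<in> Hom C A B" "f \<cdot>\<^bsub>C\<^esub> a = b \<cdot>\<^bsub>C\<^esub> Ta f"
    and g: "g \<in> Hom C B D" "g \<cdot>\<^bsub>C\<^esub> b = d \<cdot>\<^bsub>C\<^esub> Ta g"
    using assms(5,6) by (auto simp: algebra_hom_def)
  note Tf = T.map_hom[OF f(1)] and Tg = T.map_hom[OF g(1)]
  have "(g \<cdot>\<^bsub>C\<^esub> f) \<cdot>\<^bsub>C\<^esub> a = g \<cdot>\<^bsub>C\<^esub> (b \<cdot>\<^bsub>C\<^esub> Ta f)"
    by (simp add: T.source.comp_assoc[OF a f(1) g(1)] f(2))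
  also have "\<dots> = (d \<cdot>\<^bsub>C\<^esub> Ta g) \<cdot>\<^bsub>C\<^esub> Ta f"
    by (simp add: T.source.comp_assoc[OF Tf b g(1), symmetric] g(2))
  also have "\<dots> = d \<cdot>\<^bsub>C\<^esub> Ta (g \<cdot>\<^bsub>C\<^esub> f)"
    by (simp add: T.source.comp_assoc[OF Tf Tg d] T.map_comp[OF f(1) g(1)])
  finally show ?thesis
    using T.source.comp_hom[OF f(1) g(1)] by (simp add: algebra_hom_def)
qed

lemma FEM_algebraD:
  assumes "FEM_algebra C dag To Ta \<mu> \<eta> (A, a)"
  shows "A \<in> Ob C" "a \<in> Hom C (To A) A" "\<mu> A \<cdot>\<^bsub>C\<^esub> dag (Ta a) = Ta a \<cdot>\<^bsub>C\<^esub> dag (\<mu> A)"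
  using assms by (auto simp: FEM_algebra_def EM_algebra_def)

lemma Ob_FEM: "Ob (FEM C dag To Ta \<mu> \<eta>) = {X. FEM_algebra C dag To Ta \<mu> \<eta> X}"
  by (simp add: FEM_def)

lemma Hom_FEM:
  "u \<in> Hom (FEM C dag To Ta \<mu> \<eta>) X Y \<longleftrightarrow>
    FEM_algebra C dag To Ta \<mu> \<eta> X \<and> FEM_algebra C dag To Ta \<mu> \<eta> Y \<and>
    (\<exists>f. u = (X, f, Y) \<and> algebra_hom C Ta X Y f)"
  by (auto simp: Hom_def FEM_def)

lemma Id_FEM: "Id (FEM C dag To Ta \<mu> \<eta>) (A, a) = ((A, a), Id C A, (A, a))"
  by (simp add: FEM_def)

lemma Comp_FEM: "(Y, g, Z) \<cdot>\<^bsub>FEM C dag To Ta \<mu> \<eta>\<^esub> (X, f, Y') = (X, g \<cdot>\<^bsub>C\<^esub> f, Z)"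
  by (simp add: FEM_def)

text \<open>This places the middle component of an arrow of \<open>FEM\<close> in a hom-set of
  \<open>C\<close>, so that the laws of \<open>FEM\<close> reduce to those of
  \<open>C\<close>.\<close>

lemma algebra_homD: "algebra_hom C Ta X Y f \<Longrightarrow> f \<in> Hom C (fst X) (fst Y)"
  by (cases X; cases Y) (simp add: algebra_hom_def)

lemma category_FEM:
  assumes "cat_functor C C To Ta"
  shows "category (FEM C dag To Ta \<mu> \<eta>)" (is "category ?F")
proof -
  interpret T: cat_functor C C To Ta by fact
  show ?thesis
  proof
    fix u assume "u \<in> Arr ?F"
    then show "Dom ?F u \<in> Ob ?F" "Cod ?F u \<in> Ob ?F" by (auto simp: FEM_def)
  next
    fix X assume "X \<in> Ob ?F"
    then show "Id ?F X \<in> Hom ?F X X"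
      by (cases X) (auto simp: Ob_FEM Hom_FEM Id_FEM FEM_algebraD algebra_hom_id[OF assms])
  next
    fix u v X Y Z assume "u \<in> Hom ?F X Y" "v \<in> Hom ?F Y Z"
    then show "v \<cdot>\<^bsub>?F\<^esub> u \<in> Hom ?F X Z"
      by (cases X; cases Y; cases Z)
        (auto simp: Hom_FEM Comp_FEM dest: FEM_algebraD intro!: algebra_hom_comp[OF assms])
  next
    fix u X Y assume "u \<in> Hom ?F X Y"
    then show "Id ?F Y \<cdot>\<^bsub>?F\<^esub> u = u" "u \<cdot>\<^bsub>?F\<^esub> Id ?F X = u"
      by (cases X; cases Y;
          auto simp: Hom_FEM Comp_FEM Id_FEM T.source.id_left T.source.id_right
            dest!: algebra_homD)+
  next
    fix u v w X Y Z W
    assume "u \<in> Hom ?F X Y" "v \<in> Hom ?F Y Z" "w \<in> Hom ?F Z W"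
    then show "(w \<cdot>\<^bsub>?F\<^esub> v) \<cdot>\<^bsub>?F\<^esub> u = w \<cdot>\<^bsub>?F\<^esub> (v \<cdot>\<^bsub>?F\<^esub> u)"
      by (auto simp: Hom_FEM Comp_FEM T.source.comp_assoc dest!: algebra_homD)
  qed
qed

section \<open>Daggers of homomorphisms of FEM-algebras\<close>

context dagger_frobenius_monad
begin

sublocale T: cat_functor C C To Ta by (rule endofunctor)
sublocale M: nat_trans C C "\<lambda>A. To (To A)" "\<lambda>f. Ta (Ta f)" To Ta \<mu> by (rule mult_nat)
sublocale U: nat_trans C C "\<lambda>A. A" "\<lambda>f. f" To Ta \<eta> by (rule unit_nat)

text \<open>Take the dagger of the naturality square of \<open>\<mu>\<close> at
  \<open>dag f\<close>; since \<open>Ta\<close> commutes with \<open>dag\<close>, the two daggers on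
  \<open>f\<close> cancel.\<close>

lemma dag_mult_naturality:
  assumes f: "f \<in> Hom C A B"
  shows "dag (\<mu> B) \<cdot> Ta f = Ta (Ta f) \<cdot> dag (\<mu> A)"
proof -
  note df = dag_hom[OF f] and A = Hom_obs(1)[OF f] and B = Hom_obs(2)[OF f]
  have "dag (Ta (dag f) \<cdot> \<mu> B) = dag (\<mu> A \<cdot> Ta (Ta (dag f)))"
    using M.naturality[OF df] by simp
  moreover have "dag (Ta (dag f) \<cdot> \<mu> B) = dag (\<mu> B) \<cdot> dag (Ta (dag f))"
    using dag_comp[OF M.component[OF B] T.map_hom[OF df]] .
  moreover have "dag (\<mu> A \<cdot> Ta (Ta (dag f))) = dag (Ta (Ta (dag f))) \<cdot> dag (\<mu> A)"
    using dag_comp[OF T.map_hom[OF T.map_hom[OF df]] M.component[OF A]] .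
  moreover have "dag (Ta (dag f)) = Ta f" "dag (Ta (Ta (dag f))) = Ta (Ta f)"
    using functor_dagger[OF arr_of_hom[OF df]] dag_dag[OF f]
      functor_dagger[OF arr_of_hom[OF T.map_hom[OF df]]] by simp_all
  ultimately show ?thesis by simp
qed

lemma FEM_structure_dagger:
  assumes "FEM_algebra C dag To Ta \<mu> \<eta> (A, a)"
  shows "dag a = (Ta a \<cdot> dag (\<mu> A)) \<cdot> \<eta> A"
proof -
  note A = FEM_algebraD(1)[OF assms] and a = FEM_algebraD(2)[OF assms]
  note da = dag_hom[OF a]
  have "(Ta a \<cdot> dag (\<mu> A)) \<cdot> \<eta> A = (\<mu> A \<cdot> Ta (dag a)) \<cdot> \<eta> A"
    using FEM_algebraD(3)[OF assms] functor_dagger[OF arr_of_hom[OF a]] by simp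
  \<comment> \<open>Naturality is taken at \<open>dag a\<close>, an arrow from \<open>A\<close> to
    \<open>To A\<close>, so the component at \<open>To A\<close> appears and
    \<open>unit_left\<close> applies next.\<close>
  also have "\<dots> = \<mu> A \<cdot> (\<eta> (To A) \<cdot> dag a)"
    using comp_assoc[OF U.component[OF A] T.map_hom[OF da] M.component[OF A]]
      U.naturality[OF da] by simp
  also have "\<dots> = dag a"
    using comp_assoc[OF da U.component[OF T.map_ob[OF A]] M.component[OF A]]
      unit_left[OF A] id_left[OF da] by simp
  finally show ?thesis by simp
qed

lemma algebra_hom_dagger:
  assumes "FEM_algebra C dag To Ta \<mu> \<eta> (A, a)" "FEM_algebra C dag To Ta \<mu> \<eta> (B, b)"
    and "algebra_hom C Ta (A, a) (B, b) f"
  shows "algebra_hom C Ta (B, b) (A, a) (dag f)"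
proof -
  note A = FEM_algebraD(1)[OF assms(1)] and a = FEM_algebraD(2)[OF assms(1)]
  note B = FEM_algebraD(1)[OF assms(2)] and b = FEM_algebraD(2)[OF assms(2)]
  have f: "f \<in> Hom C A B" and fa: "f \<cdot> a = b \<cdot> Ta f"
    using assms(3) by (auto simp: algebra_hom_def)
  note Tf = T.map_hom[OF f] and TTf = T.map_hom[OF T.map_hom[OF f]]
  note Ta = T.map_hom[OF a] and Tb = T.map_hom[OF b]
  note mA = dag_hom[OF M.component[OF A]] and mB = dag_hom[OF M.component[OF B]]
  note uA = U.component[OF A] and uB = U.component[OF B]
  \<comment> \<open>From here \<open>f\<close> travels leftwards, past \<open>\<eta>\<close> as
    \<open>Ta f\<close>, past \<open>dag \<mu>\<close> as \<open>Ta (Ta f)\<close>, and past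
    \<open>Ta b\<close> as \<open>Ta f\<close> again.\<close>
  have "dag b \<cdot> f = (Ta b \<cdot> dag (\<mu> B)) \<cdot> (\<eta> B \<cdot> f)"
    using FEM_structure_dagger[OF assms(2)] comp_assoc[OF f uB comp_hom[OF mB Tb]] by simp
  also have "\<dots> = ((Ta b \<cdot> dag (\<mu> B)) \<cdot> Ta f) \<cdot> \<eta> A"
    using U.naturality[OF f] comp_assoc[OF uA Tf comp_hom[OF mB Tb]] by simp
  also have "(Ta b \<cdot> dag (\<mu> B)) \<cdot> Ta f = (Ta b \<cdot> Ta (Ta f)) \<cdot> dag (\<mu> A)"
    using comp_assoc[OF Tf mB Tb] comp_assoc[OF mA TTf Tb] dag_mult_naturality[OF f] by simp
  \<comment> \<open>This is the image under \<open>Ta\<close> of the homomorphism equation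
    \<open>fa\<close>.\<close>
  also have "Ta b \<cdot> Ta (Ta f) = Ta f \<cdot> Ta a"
    using T.map_comp[OF Tf b] T.map_comp[OF a f] fa by simp
  \<comment> \<open>What stands to the right of \<open>Ta f\<close> is the formula for
    \<open>dag a\<close>, now read backwards.\<close>
  also have "((Ta f \<cdot> Ta a) \<cdot> dag (\<mu> A)) \<cdot> \<eta> A = Ta f \<cdot> dag a"
    using comp_assoc[OF mA Ta Tf] comp_assoc[OF uA comp_hom[OF mA Ta] Tf]
      FEM_structure_dagger[OF assms(1)] by simp
  finally have "dag (dag b \<cdot> f) = dag (Ta f \<cdot> dag a)" by simp
  then have "dag f \<cdot> b = a \<cdot> Ta (dag f)"
    using dag_comp[OF f dag_hom[OF b]] dag_comp[OF dag_hom[OF a] Tf]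
      dag_dag[OF a] dag_dag[OF b] functor_dagger[OF arr_of_hom[OF f]] by simp
  then show ?thesis using dag_hom[OF f] by (simp add: algebra_hom_def)
qed

text \<open>By \<open>algebra_hom_dagger\<close> the swapped triple is again an arrow; the functor
  laws and involutivity are those of \<open>dag\<close> on middle components.\<close>

lemma dagger_category_FEM:
  "dagger_category (FEM C dag To Ta \<mu> \<eta>) (FEM_dagger dag)" (is "dagger_category ?F ?d")
proof -
  interpret F: category ?F by (rule category_FEM) (rule endofunctor)
  \<comment> \<open>Together \<open>F\<close> and \<open>O\<close> settle the two category
    conditions of \<open>cat_functor\<close>, which leaves only the four functor laws to
    prove.\<close>
  interpret O: category "opposite ?F" by (rule category_opposite) (rule F.category_axioms)
  have d: "?d (X, f, Y) = (Y, dag f, X)" for X f Y by (simp add: FEM_dagger_def)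
  have "cat_functor (opposite ?F) ?F (\<lambda>A. A) ?d"
  proof
    fix X assume "X \<in> Ob (opposite ?F)"
    then show "X \<in> Ob ?F" by (simp add: opposite_def)
  next
    fix u X Y assume "u \<in> Hom (opposite ?F) X Y"
    then show "?d u \<in> Hom ?F X Y"
      unfolding Hom_opposite
      by (cases X; cases Y) (auto simp: Hom_FEM d intro: algebra_hom_dagger)
  next
    fix X assume "X \<in> Ob (opposite ?F)"
    then have "FEM_algebra C dag To Ta \<mu> \<eta> X" by (simp add: opposite_def Ob_FEM)
    then show "?d (Id (opposite ?F) X) = Id ?F X"
      by (cases X) (simp add: opposite_def Id_FEM d dag_id FEM_algebraD)
  next
    fix u v X Y Z assume "u \<in> Hom (opposite ?F) X Y" "v \<in> Hom (opposite ?F) Y Z"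
    \<comment> \<open>Read in \<open>FEM\<close> itself, both arrows are reversed and the composite
      of \<open>v\<close> after \<open>u\<close> becomes \<open>u\<close> after
      \<open>v\<close>.\<close>
    then have "u \<in> Hom ?F Y X" "v \<in> Hom ?F Z Y" by simp_all
    then have "?d (u \<cdot>\<^bsub>?F\<^esub> v) = ?d v \<cdot>\<^bsub>?F\<^esub> ?d u"
      by (auto simp: Hom_FEM Comp_FEM d dag_comp dest!: algebra_homD)
    then show "?d (v \<cdot>\<^bsub>opposite ?F\<^esub> u) = ?d v \<cdot>\<^bsub>?F\<^esub> ?d u" by (simp add: opposite_def)
  qed
  moreover have "?d (?d u) = u" if "u \<in> Arr ?F" for u
    using that by (auto simp: FEM_def d dag_dag dest!: algebra_homD)
  ultimately show ?thesis
    by (intro dagger_category.intro dagger_category_axioms.intro F.category_axioms)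
qed

end

theorem lemma6p9:
  fixes C :: "('o, 'm) category"
    and dag :: "'m \<Rightarrow> 'm"
    and To :: "'o \<Rightarrow> 'o" and Ta :: "'m \<Rightarrow> 'm"
    and \<mu> \<eta> :: "'o \<Rightarrow> 'm"
  assumes "dagger_frobenius_monad C dag To Ta \<mu> \<eta>"
  shows "(\<forall>A a B b f.
            FEM_algebra C dag To Ta \<mu> \<eta> (A, a) \<longrightarrow> FEM_algebra C dag To Ta \<mu> \<eta> (B, b) \<longrightarrow>
            algebra_hom C Ta (A, a) (B, b) f \<longrightarrow> algebra_hom C Ta (B, b) (A, a) (dag f))
       \<and> dagger_category (FEM C dag To Ta \<mu> \<eta>) (FEM_dagger dag)"
proof -
  interpret dagger_frobenius_monad C dag To Ta \<mu> \<eta> by fact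
  show ?thesis using algebra_hom_dagger dagger_category_FEM by blast
qed

end
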